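(* Let $G$ be a group and let $(C,\star)$ be a finite conjugation quandle over $G$. Denote $H := \langle C\rangle \leq G$. Then for any $c\in C$ the following are equivalent: (1) the left translation $L_c$ in $(C,\star)$ contains a regular cycle; (2) there is $z\in C$ such that $\langle c\rangle\cap C_H(z)\leq Z(H)$.
   Context: A quandle is a nonempty set $Q$ with a binary operation $\star$ such that for each $a\in Q$ one has $a\star a=a$ and the left translation $L_a:Q\to Q$, $x\mapsto a\star x$, is an automorphism of $(Q,\star)$. A conjugation quandle over a group $G$ is a quandle $(C,\star)$ with $C\subseteq G$ and $a\star b=aba^{-1}$ for all $a,b\in C$. A permutation of a finite nonempty set contains a regular cycle if every one of its cycle lengths (fixed points count as cycles of length 1) divides its largest cycle length. $\langle C\rangle$ is the subgroup of $G$ generated by $C$, $C_H(z)=\{h\in H\mid hz=zh\}$ is the centralizer, and $Z(H)$ is the center of $H$. *)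

theory Defs
  imports "HOL-Algebra.Generated_Groups" "HOL-Combinatorics.Orbits"
begin

definition magma_automorphism :: "'a set \<Rightarrow> ('a \<Rightarrow> 'a \<Rightarrow> 'a) \<Rightarrow> ('a \<Rightarrow> 'a) \<Rightarrow> bool" where
  "magma_automorphism Q op f \<longleftrightarrow>
     bij_betw f Q Q \<and> (\<forall>x\<in>Q. \<forall>y\<in>Q. f (op x y) = op (f x) (f y))"

(* The operation is only constrained on the carrier Q. The left translation by a is the
   partial application star a, regarded as a map on Q. *)
locale quandle =
  fixes Q :: "'a set" and star :: "'a \<Rightarrow> 'a \<Rightarrow> 'a"
  assumes nonempty: "Q \<noteq> {}"
    and star_closed: "\<lbrakk>a \<in> Q; b \<in> Q\<rbrakk> \<Longrightarrow> star a b \<in> Q"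
    and star_idem: "a \<in> Q \<Longrightarrow> star a a = a"
    and left_translation_aut: "a \<in> Q \<Longrightarrow> magma_automorphism Q star (star a)"

locale conjugation_quandle = group G + quandle C star
  for G (structure) and C and star +
  assumes subset_group: "C \<subseteq> carrier G"
    and star_conj: "\<lbrakk>a \<in> C; b \<in> C\<rbrakk> \<Longrightarrow> star a b = a \<otimes> b \<otimes> inv a"

(* Intended for a map f that restricts to a permutation of the finite nonempty set A:
   then the orbits of points of A are exactly the supports of the cycles of f on A,
   fixed points giving cycles of length 1. *)
definition cycle_lengths :: "'a set \<Rightarrow> ('a \<Rightarrow> 'a) \<Rightarrow> nat set" where
  "cycle_lengths A f = (\<lambda>x. card (orbit f x)) ` A"

definition contains_regular_cycle :: "'a set \<Rightarrow> ('a \<Rightarrow> 'a) \<Rightarrow> bool" where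
  "contains_regular_cycle A f \<longleftrightarrow>
     (\<forall>l \<in> cycle_lengths A f. l dvd Max (cycle_lengths A f))"

definition centralizer :: "('a, 'b) monoid_scheme \<Rightarrow> 'a \<Rightarrow> 'a set" where
  "centralizer H z = {h \<in> carrier H. h \<otimes>\<^bsub>H\<^esub> z = z \<otimes>\<^bsub>H\<^esub> h}"

definition center :: "('a, 'b) monoid_scheme \<Rightarrow> 'a set" where
  "center H = {h \<in> carrier H. \<forall>k \<in> carrier H. h \<otimes>\<^bsub>H\<^esub> k = k \<otimes>\<^bsub>H\<^esub> h}"

end

(* The powers of L_c act on C by conjugation with the powers of c, so the cycle of L_c through b
   has length dividing n iff c^n commutes with b, and c^n is central in H iff n is divisible
   by every cycle length. Hence z satisfies (2) iff every cycle length divides the one at z. *)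
theory Submission
  imports Defs
begin

text \<open>\<open>orbit f x\<close> starts at \<open>f x\<close>, so membership of \<open>x\<close>
  says that \<open>x\<close> is periodic. Nothing is known about \<open>f\<close> outside
  \<open>A\<close>; extending it there by the identity gives a permutation of the whole type, and
  the orbit of \<open>x\<close> never leaves \<open>A\<close>.\<close>

lemma in_own_orbit_if_bij_betw:
  assumes "bij_betw f A A" "finite A" "x \<in> A"
  shows "x \<in> orbit f x"
proof -
  define g where "g = (\<lambda>y. if y \<in> A then f y else y)"
  have "bij_betw g A A"
    using assms(1) by (subst bij_betw_cong[where g = f]) (auto simp: g_def)
  then have "g permutes A"
    by (rule bij_imp_permutes) (simp add: g_def)
  then have "permutation g"
    using assms(2) permutation_permutes by blast
  then have "x \<in> orbit g x"
    by (rule permutation_self_in_orbit)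
  moreover have "orbit f x = orbit g x"
    using assms by (intro orbit_cong0[where A = A]) (auto simp: g_def bij_betw_def)
  ultimately show ?thesis by simp
qed

text \<open>The least positive return time \<open>d\<close> of \<open>x\<close> is the size of the
  orbit, because the first \<open>d\<close> iterates are distinct and exhaust it. Reducing
  \<open>n\<close> modulo \<open>d\<close> does not move the iterate, and a nonzero remainder would
  be too early a return.\<close>

lemma card_orbit_dvd_iff:
  assumes "x \<in> orbit f x"
  shows "card (orbit f x) dvd n \<longleftrightarrow> (f ^^ n) x = x"
proof -
  define d where "d = funpow_dist1 f x x"
  have fd: "(f ^^ d) x = x"
    using funpow_dist1_prop[OF assms] by (simp add: d_def)
  have card: "card (orbit f x) = d"
    using orbit_conv_funpow_dist1[OF assms] card_image[OF inj_on_funpow_dist1[OF assms]]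
    by (simp add: d_def)
  have "(f ^^ (n mod d)) x \<noteq> x" if "n mod d \<noteq> 0"
  proof (rule funpow_dist1_least)
    show "0 < n mod d" using that by blast
    show "n mod d < funpow_dist1 f x x" unfolding d_def by (rule mod_less_divisor) simp
  qed
  then have "n mod d = 0 \<longleftrightarrow> (f ^^ (n mod d)) x = x"
    by fastforce
  then show ?thesis
    unfolding card dvd_eq_mod_eq_0 funpow_mod_eq[OF fd] .
qed

text \<open>The maximum is attained at some point; conversely, a cycle length that all others divide
  bounds them and so is the maximum. Positivity matters here: everything divides 0, the
  \<open>card\<close> of an infinite orbit.\<close>

lemma contains_regular_cycle_iff:
  assumes "finite A" "A \<noteq> {}" "\<And>x. x \<in> A \<Longrightarrow> card (orbit f x) > 0"
  shows "contains_regular_cycle A f \<longleftrightarrow>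
         (\<exists>z\<in>A. \<forall>x\<in>A. card (orbit f x) dvd card (orbit f z))"
proof
  assume regular: "contains_regular_cycle A f"
  have "Max (cycle_lengths A f) \<in> cycle_lengths A f"
    using assms by (intro Max_in) (auto simp: cycle_lengths_def)
  then obtain z where "z \<in> A" "Max (cycle_lengths A f) = card (orbit f z)"
    unfolding cycle_lengths_def by blast
  with regular show "\<exists>z\<in>A. \<forall>x\<in>A. card (orbit f x) dvd card (orbit f z)"
    by (auto simp: contains_regular_cycle_def cycle_lengths_def)
next
  assume "\<exists>z\<in>A. \<forall>x\<in>A. card (orbit f x) dvd card (orbit f z)"
  then obtain z where z: "z \<in> A" "\<And>x. x \<in> A \<Longrightarrow> card (orbit f x) dvd card (orbit f z)"
    by blast
  then have "Max (cycle_lengths A f) = card (orbit f z)"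
    using assms by (intro Max_eqI) (auto simp: cycle_lengths_def intro: dvd_imp_le)
  with z show "contains_regular_cycle A f"
    by (auto simp: contains_regular_cycle_def cycle_lengths_def)
qed

context group
begin

lemma commutes_inv_iff:
  assumes "x \<in> carrier G" "y \<in> carrier G"
  shows "inv x \<otimes> y = y \<otimes> inv x \<longleftrightarrow> x \<otimes> y = y \<otimes> x"
proof -
  have "inv x \<otimes> y = y \<otimes> inv x \<longleftrightarrow> y = x \<otimes> (y \<otimes> inv x)"
    using assms by (intro inv_solve_left') auto
  also have "\<dots> \<longleftrightarrow> y = (x \<otimes> y) \<otimes> inv x"
    using m_assoc[of x y "inv x"] assms by simp
  also have "\<dots> \<longleftrightarrow> x \<otimes> y = y \<otimes> x"
    using assms by (intro inv_solve_right) auto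
  finally show ?thesis .
qed

lemma int_pow_commutes_iff:
  assumes "x \<in> carrier G" "y \<in> carrier G"
  shows "x [^] (k::int) \<otimes> y = y \<otimes> x [^] k \<longleftrightarrow>
         x [^] nat \<bar>k\<bar> \<otimes> y = y \<otimes> x [^] nat \<bar>k\<bar>"
proof (cases k rule: int_cases2)
  case (nonneg n)
  then show ?thesis by (simp add: int_pow_int)
next
  case (nonpos n)
  then show ?thesis
    using commutes_inv_iff[of "x [^] n" y] assms by (simp add: int_pow_neg_int)
qed

text \<open>The elements commuting with \<open>x\<close> are closed under products and inverses, so
  induction over \<open>generate\<close> applies.\<close>

lemma commutes_generate:
  assumes "x \<in> carrier G" "A \<subseteq> carrier G" "\<And>a. a \<in> A \<Longrightarrow> x \<otimes> a = a \<otimes> x"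
    and "h \<in> generate G A"
  shows "x \<otimes> h = h \<otimes> x"
  using assms(4)
proof (induction h rule: generate.induct)
  case (eng a b)
  then have "a \<in> carrier G" "b \<in> carrier G"
    using generate_in_carrier[OF assms(2)] by auto
  then have "x \<otimes> (a \<otimes> b) = a \<otimes> (x \<otimes> b)"
    using eng.IH(1) assms(1) by (simp flip: m_assoc)
  with \<open>a \<in> carrier G\<close> \<open>b \<in> carrier G\<close> show ?case
    using eng.IH(2) assms(1) by (simp add: m_assoc)
next
  case (inv a)
  then show ?case
    using commutes_inv_iff[of a x] assms(1,3) subsetD[OF assms(2)] by simp
qed (use assms in auto)

lemma center_subgroup_generated_iff:
  assumes "A \<subseteq> carrier G" "x \<in> generate G A"
  shows "x \<in> center (subgroup_generated G A) \<longleftrightarrow> (\<forall>a\<in>A. x \<otimes> a = a \<otimes> x)"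
proof -
  have "carrier (subgroup_generated G A) = generate G A"
    using assms(1) by (simp add: carrier_subgroup_generated Int_absorb1)
  then show ?thesis
    unfolding center_def
    using assms(2) commutes_generate[OF generate_in_carrier[OF assms] assms(1)]
      generate.incl[of _ A G]
    by auto
qed

end

context conjugation_quandle
begin

text \<open>Both claims share one induction: \<open>star_conj\<close> speaks only about elements of
  \<open>C\<close>, so the formula for the next iterate needs the current one to lie in
  \<open>C\<close>.\<close>

lemma left_translation_funpow:
  assumes "c \<in> C" "b \<in> C"
  shows "(star c ^^ n) b = c [^] n \<otimes> b \<otimes> inv (c [^] n)"
    and "(star c ^^ n) b \<in> C"
proof (induction n)
  case 0
  show "(star c ^^ 0) b = c [^] (0::nat) \<otimes> b \<otimes> inv (c [^] (0::nat))" "(star c ^^ 0) b \<in> C"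
    using assms subset_group by auto
next
  case (Suc n)
  have carr: "c \<in> carrier G" "b \<in> carrier G"
    using assms subset_group by auto
  show "(star c ^^ Suc n) b \<in> C"
    using Suc assms by (simp add: star_closed)
  have "(star c ^^ Suc n) b = c \<otimes> (c [^] n \<otimes> b \<otimes> inv (c [^] n)) \<otimes> inv c"
    using Suc assms by (simp add: star_conj)
  also have "\<dots> = (c \<otimes> c [^] n) \<otimes> b \<otimes> inv (c \<otimes> c [^] n)"
    using carr by (simp add: m_assoc inv_mult_group)
  \<comment> \<open>The recursion for powers multiplies on the right, but the new factor arrives on
    the left.\<close>
  also have "c \<otimes> c [^] n = c [^] Suc n"
    using nat_pow_Suc2[OF carr(1)] by simp
  finally show "(star c ^^ Suc n) b = c [^] Suc n \<otimes> b \<otimes> inv (c [^] Suc n)" .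
qed

lemma in_own_left_translation_orbit:
  assumes "finite C" "c \<in> C" "b \<in> C"
  shows "b \<in> orbit (star c) b"
  using assms left_translation_aut
  by (auto simp: magma_automorphism_def intro: in_own_orbit_if_bij_betw)

lemma cycle_length_dvd_iff_commutes:
  assumes "finite C" "c \<in> C" "b \<in> C"
  shows "card (orbit (star c) b) dvd n \<longleftrightarrow> c [^] n \<otimes> b = b \<otimes> c [^] n"
proof -
  have "c [^] n \<in> carrier G" "b \<in> carrier G"
    using assms subset_group by auto
  then have "c [^] n \<otimes> b \<otimes> inv (c [^] n) = b \<longleftrightarrow> c [^] n \<otimes> b = b \<otimes> c [^] n"
    by (metis inv_solve_right m_closed)
  then show ?thesis
    using card_orbit_dvd_iff[OF in_own_left_translation_orbit] left_translation_funpow(1) assms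
    by simp
qed

lemma cyclic_Int_centralizer_subset_center_iff:
  assumes "finite C" "c \<in> C" "z \<in> C"
  shows "generate G {c} \<inter> centralizer (subgroup_generated G C) z \<subseteq> center (subgroup_generated G C)
    \<longleftrightarrow> (\<forall>b\<in>C. card (orbit (star c) b) dvd card (orbit (star c) z))"
    (is "?P \<longleftrightarrow> ?Q")
proof -
  let ?l = "\<lambda>b. card (orbit (star c) b)"
  have carr: "c \<in> carrier G" and C: "\<And>b. b \<in> C \<Longrightarrow> b \<in> carrier G"
    using assms subset_group by auto
  have carrH: "carrier (subgroup_generated G C) = generate G C"
    using subset_group by (simp add: carrier_subgroup_generated Int_absorb1)
  have cyc: "generate G {c} = range (\<lambda>k::int. c [^] k)"
    using generate_pow[OF carr] by auto
  \<comment> \<open>\<open>centralizer\<close> and \<open>center\<close> contain only elements of H,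
    so powers of \<open>c\<close> must first be placed there.\<close>
  have in_H: "c [^] k \<in> generate G C" for k :: int
    using cyc mono_generate[of "{c}" C] assms(2) by auto
  have com: "c [^] k \<otimes> b = b \<otimes> c [^] k \<longleftrightarrow> ?l b dvd nat \<bar>k\<bar>" if "b \<in> C" for k :: int and b
    unfolding int_pow_commutes_iff[OF carr C[OF that]]
      cycle_length_dvd_iff_commutes[OF assms(1,2) that] ..
  have "?P \<longleftrightarrow> (\<forall>k::int. ?l z dvd nat \<bar>k\<bar> \<longrightarrow> (\<forall>b\<in>C. ?l b dvd nat \<bar>k\<bar>))"
  proof -
    have "c [^] k \<in> centralizer (subgroup_generated G C) z \<longleftrightarrow> ?l z dvd nat \<bar>k\<bar>" for k :: int
      unfolding centralizer_def carrH mult_subgroup_generated com[OF assms(3), symmetric]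
      using in_H by simp
    moreover have "c [^] k \<in> center (subgroup_generated G C) \<longleftrightarrow> (\<forall>b\<in>C. ?l b dvd nat \<bar>k\<bar>)"
      for k :: int
      unfolding center_subgroup_generated_iff[OF subset_group in_H] using com by blast
    ultimately show ?thesis
      unfolding cyc by blast
  qed
  also have "\<dots> \<longleftrightarrow> ?Q"
  proof
    assume "\<forall>k::int. ?l z dvd nat \<bar>k\<bar> \<longrightarrow> (\<forall>b\<in>C. ?l b dvd nat \<bar>k\<bar>)"
    \<comment> \<open>The exponent \<open>?l z\<close> is the decisive one: this power of
      \<open>c\<close> generates the intersection of the cyclic group with the centralizer of
      \<open>z\<close>.\<close>
    from this[rule_format, of "int (?l z)"] show ?Q by simp
  qed (meson dvd_trans)
  finally show ?thesis .
qed

end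

theorem proposition4p1:
  fixes G :: "('a, 'b) monoid_scheme"
    and C :: "'a set"
    and star :: "'a \<Rightarrow> 'a \<Rightarrow> 'a"
    and H :: "('a, 'b) monoid_scheme"
    and c :: 'a
  assumes "group G"
    and "conjugation_quandle G C star"
    and "finite C"
    and "H = subgroup_generated G C"
    and "c \<in> C"
  shows "contains_regular_cycle C (star c) \<longleftrightarrow>
         (\<exists>z \<in> C. generate G {c} \<inter> centralizer H z \<subseteq> center H)"
proof -
  interpret conjugation_quandle G C star by fact
  \<comment> \<open>Periodicity makes the orbit both finite and nonempty, so \<open>card\<close> is
    a true size and not the default 0.\<close>
  have pos: "card (orbit (star c) b) > 0" if "b \<in> C" for b
    using in_own_left_translation_orbit[OF assms(3,5) that] finite_orbit
    by (auto simp: card_gt_0_iff)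
  have "contains_regular_cycle C (star c) \<longleftrightarrow>
      (\<exists>z\<in>C. \<forall>b\<in>C. card (orbit (star c) b) dvd card (orbit (star c) z))"
    by (rule contains_regular_cycle_iff[OF assms(3) nonempty pos])
  then show ?thesis
    unfolding assms(4) using cyclic_Int_centralizer_subset_center_iff[OF assms(3,5)] by blast
qed

end
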